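(* Let $\varepsilon>0$. Let $(a_n)$ be a sequence in $\mathbb{D}$ that is interpolating for $H^\infty$ and is a Frostman sequence, and let $(z_n)$ be a $\rho$-separated sequence in $\mathbb{D}$ with $\rho(a_n,z_n)\le 1-\varepsilon$ for all $n$. Then $(z_n)$ is a Frostman sequence.
   Context: $\mathbb{D}$ is the open unit disk, $\mathbb{T}$ the unit circle, and $H^\infty$ the space of bounded analytic functions on $\mathbb{D}$. The pseudohyperbolic distance is $\rho(a,z)=\left|\frac{z-a}{1-\overline{a}z}\right|$ for $a,z\in\mathbb{D}$. A sequence $(z_n)$ in $\mathbb{D}$ is $\rho$-separated if $\inf_{j\ne k}\rho(z_j,z_k)>0$. A sequence $(a_n)$ in $\mathbb{D}$ is interpolating for $H^\infty$ if for every bounded sequence $(\alpha_n)$ of complex numbers there is $f\in H^\infty$ with $f(a_n)=\alpha_n$ for all $n$. A sequence $(a_j)$ in $\mathbb{D}$ is a Frostman sequence if $\sup\left\{\sum_j\frac{1-|a_j|}{|\zeta-a_j|}:\zeta\in\mathbb{T}\right\}<\infty$. *)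

theory Defs
  imports "HOL-Complex_Analysis.Complex_Analysis"
begin

abbreviation unit_disk :: "complex set"
  where "unit_disk \<equiv> ball 0 1"

abbreviation unit_circle :: "complex set"
  where "unit_circle \<equiv> sphere 0 1"

definition H_infty :: "(complex \<Rightarrow> complex) set"
  where "H_infty = {f. f holomorphic_on unit_disk \<and> bounded (f ` unit_disk)}"

definition pseudohyp :: "complex \<Rightarrow> complex \<Rightarrow> real"
  where "pseudohyp a z = cmod ((z - a) / (1 - cnj a * z))"

definition pseudohyp_separated :: "(nat \<Rightarrow> complex) \<Rightarrow> bool"
  where "pseudohyp_separated z \<longleftrightarrow>
    range z \<subseteq> unit_disk \<and> Inf {pseudohyp (z j) (z k) |j k. j \<noteq> k} > 0"

definition interpolating :: "(nat \<Rightarrow> complex) \<Rightarrow> bool"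
  where "interpolating a \<longleftrightarrow>
    range a \<subseteq> unit_disk \<and>
    (\<forall>\<alpha> :: nat \<Rightarrow> complex. bounded (range \<alpha>) \<longrightarrow> (\<exists>f\<in>H_infty. \<forall>n. f (a n) = \<alpha> n))"

text \<open>The sum and the supremum are taken in \<open>[0, \<infinity>]\<close>, so a divergent series has the value
  \<open>\<infinity>\<close>; over the reals \<open>suminf\<close> and \<open>Sup\<close> would be unspecified where they do not exist.\<close>

definition frostman :: "(nat \<Rightarrow> complex) \<Rightarrow> bool"
  where "frostman a \<longleftrightarrow>
    range a \<subseteq> unit_disk \<and>
    (SUP \<zeta>\<in>unit_circle. \<Sum>j. ennreal ((1 - cmod (a j)) / cmod (\<zeta> - a j))) < \<infinity>"

end

theory Submission
  imports Defs
begin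

text \<open>The Frostman sums are compared term by term: a pseudohyperbolic bound
  \<open>\<rho>(a, z) \<le> 1 - \<epsilon>\<close> makes both \<open>1 - |a|\<close> and \<open>|\<zeta> - a|\<close> comparable to their analogues
  for \<open>z\<close>, with constants depending only on \<open>\<epsilon>\<close>.\<close>

lemma pseudohyp_commute: "pseudohyp a z = pseudohyp z a"
proof -
  have "cmod (1 - cnj z * a) = cmod (cnj (1 - cnj z * a))"
    by (rule complex_mod_cnj[symmetric])
  also have "\<dots> = cmod (1 - cnj a * z)"
    by (simp add: mult.commute)
  finally show ?thesis
    by (simp add: pseudohyp_def norm_divide norm_minus_commute)
qed

lemma pseudohyp_nonneg: "pseudohyp a z \<ge> 0"
  by (simp add: pseudohyp_def)

text \<open>The denominator d = |1 - cnj a * z| controls itself: it is at most 1 - |a|^2 + |z - a|,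
  and the hypothesis bounds |z - a| by (1 - \<epsilon>) d. Absorbing that term on the left leaves
  \<epsilon> d, which explains the factor 1 / \<epsilon>.\<close>

lemma dist_le_of_pseudohyp_le:
  assumes "\<epsilon> > 0" "cmod a < 1" "cmod z < 1" "pseudohyp a z \<le> 1 - \<epsilon>"
  shows "cmod (z - a) \<le> 2 / \<epsilon> * (1 - cmod a)"
proof -
  define d where "d = cmod (1 - cnj a * z)"
  have \<epsilon>: "\<epsilon> \<le> 1"
    using assms(4) pseudohyp_nonneg[of a z] by linarith
  have "cmod (cnj a * z) < 1"
    using mult_strict_mono'[of "cmod a" 1 "cmod z" 1] assms(2,3) by (simp add: norm_mult)
  then have "d > 0"
    by (auto simp: d_def)
  with assms(4) have za: "cmod (z - a) \<le> (1 - \<epsilon>) * d"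
    by (simp add: pseudohyp_def norm_divide d_def divide_le_eq)
  \<comment> \<open>Expand the denominator around z = a, where its value is 1 - |a|^2.\<close>
  have "1 - cnj a * z = of_real (1 - (cmod a)\<^sup>2) - cnj a * (z - a)"
    by (simp add: complex_norm_square[symmetric] algebra_simps flip: of_real_power)
  then have "d \<le> cmod (of_real (1 - (cmod a)\<^sup>2)) + cmod (cnj a * (z - a))"
    unfolding d_def by (metis norm_triangle_ineq4)
  also have "cmod (of_real (1 - (cmod a)\<^sup>2)) = 1 - (cmod a)\<^sup>2"
    using assms(2) by (simp only: norm_of_real) (simp add: power_le_one)
  \<comment> \<open>The difference of the two sides is (1 - |a|)^2.\<close>
  also have "\<dots> \<le> 2 * (1 - cmod a)"
    using zero_le_power2[of "1 - cmod a"] by (simp add: power2_diff)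
  also have "cmod (cnj a * (z - a)) \<le> cmod (z - a)"
    using assms(2) by (simp add: norm_mult mult_left_le_one_le)
  finally have "\<epsilon> * d \<le> 2 * (1 - cmod a)"
    using za by (simp add: algebra_simps)
  then have "d \<le> 2 / \<epsilon> * (1 - cmod a)"
    using assms(1) by (simp add: field_simps)
  moreover have "(1 - \<epsilon>) * d \<le> d"
    using \<open>d > 0\<close> assms(1) by (simp add: algebra_simps)
  ultimately show ?thesis
    using za by linarith
qed

text \<open>Numerator and denominator each cost one factor 1 + 2 / \<epsilon>, hence the square.
  Both estimates add |z - a| by the triangle inequality.\<close>

lemma frostman_term_le:
  assumes "\<epsilon> > 0" "cmod a < 1" "cmod z < 1" "pseudohyp a z \<le> 1 - \<epsilon>" "cmod \<zeta> = 1"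
  shows "(1 - cmod z) / cmod (\<zeta> - z) \<le> (1 + 2 / \<epsilon>)\<^sup>2 * ((1 - cmod a) / cmod (\<zeta> - a))"
proof -
  define K where "K = 1 + 2 / \<epsilon>"
  have K: "K > 0"
    using assms(1) by (simp add: K_def add_pos_pos)
  have pos: "cmod (\<zeta> - z) > 0" "cmod (\<zeta> - a) > 0"
    using assms by auto
  have "cmod (z - a) \<le> 2 / \<epsilon> * (1 - cmod a)"
    using assms(1-4) by (rule dist_le_of_pseudohyp_le)
  moreover have "cmod a - cmod z \<le> cmod (z - a)"
    by (metis norm_minus_commute norm_triangle_ineq2)
  ultimately have num: "1 - cmod z \<le> K * (1 - cmod a)"
    by (simp add: K_def algebra_simps)
  \<comment> \<open>The distance bound is now used with a and z exchanged, as
    \<open>pseudohyp\<close> is symmetric. The aim is a bound by |\<zeta> - z|, which is at least 1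
    - |z| because \<zeta> lies on the circle.\<close>
  have "cmod (z - a) \<le> 2 / \<epsilon> * (1 - cmod z)"
    using dist_le_of_pseudohyp_le[of \<epsilon> z a] assms(1-4)
    by (simp add: pseudohyp_commute norm_minus_commute)
  also have "\<dots> \<le> 2 / \<epsilon> * cmod (\<zeta> - z)"
    using norm_triangle_ineq2[of \<zeta> z] assms(1,5) by (intro mult_left_mono) auto
  finally have "cmod (\<zeta> - a) \<le> K * cmod (\<zeta> - z)"
    using norm_triangle_ineq[of "\<zeta> - z" "z - a"] by (simp add: K_def algebra_simps)
  then have "(1 - cmod z) * cmod (\<zeta> - a) \<le> (K * (1 - cmod a)) * (K * cmod (\<zeta> - z))"
    using num assms(2,3) K by (intro mult_mono) auto
  then show ?thesis
    using pos by (simp add: K_def[symmetric] field_simps power2_eq_square)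
qed

theorem theorem5p2:
  fixes \<epsilon> :: real and a z :: "nat \<Rightarrow> complex"
  assumes "\<epsilon> > 0"
    and "interpolating a"
    and "frostman a"
    and "pseudohyp_separated z"
    and "\<And>n. pseudohyp (a n) (z n) \<le> 1 - \<epsilon>"
  shows "frostman z"
proof -
  define S where "S w \<zeta> = (\<Sum>j. ennreal ((1 - cmod (w j)) / cmod (\<zeta> - w j)))"
    for w :: "nat \<Rightarrow> complex" and \<zeta>
  define C where "C = (1 + 2 / \<epsilon>)\<^sup>2"
  have a: "cmod (a n) < 1" for n
    using assms(3) by (auto simp: frostman_def image_subset_iff)
  have zran: "range z \<subseteq> unit_disk"
    using assms(4) by (simp add: pseudohyp_separated_def)
  then have z: "cmod (z n) < 1" for n
    by (auto simp: image_subset_iff)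
  \<comment> \<open>The constant C depends on neither j nor \<zeta>, so it passes through the sum
    and then the supremum. Working in [0, \<infinity>] avoids any separate summability
    argument.\<close>
  have "S z \<zeta> \<le> ennreal C * S a \<zeta>" if "\<zeta> \<in> unit_circle" for \<zeta>
  proof -
    have "ennreal ((1 - cmod (z j)) / cmod (\<zeta> - z j))
        \<le> ennreal C * ennreal ((1 - cmod (a j)) / cmod (\<zeta> - a j))" for j
      using frostman_term_le[OF assms(1) a z assms(5), of \<zeta> j] that a[of j]
      by (simp add: C_def ennreal_mult[symmetric] ennreal_leI)
    then show ?thesis
      unfolding S_def ennreal_suminf_cmult[symmetric] by (intro suminf_le) auto
  qed
  then have "(SUP \<zeta>\<in>unit_circle. S z \<zeta>) \<le> ennreal C * (SUP \<zeta>\<in>unit_circle. S a \<zeta>)"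
    by (intro SUP_least) (meson SUP_upper mult_left_mono order_trans zero_le)
  also have "\<dots> < \<infinity>"
    using assms(3) by (simp add: frostman_def S_def ennreal_mult_less_top)
  finally show ?thesis
    using zran by (simp add: frostman_def S_def)
qed

end
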